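(* Let $f_a=h_a+\overline{g_a}\in K_H$ ($a\in\mathbb{R}$, $|a|<1$) be the right half-plane mapping in $E=\{z\in\mathbb{C}:|z|<1\}$ given by $$h_a(z)=\frac{\frac{1}{1+a}z-\frac12 z^2}{(1-z)^2},\qquad g_a(z)=\frac{\frac{a}{1+a}z-\frac12 z^2}{(1-z)^2}.$$ If $f_b=h+\overline{g}\in K_H$ is given by $h(z)+g(z)=\frac{z}{1-z}$ with dilatation $\omega(z)=\frac{g'(z)}{h'(z)}=\frac{b-z}{1-bz}$ ($|b|<1$, $b\in\mathbb{R}$), then $f_a\ast f_b\in S_H$ and $f_a\ast f_b$ is CHD for $$b\ge-\frac{1+3a}{3+a}.$$
   Context: A harmonic mapping in the open unit disk $E$ is written $f=h+\overline{g}$, where $h$ is its analytic part and $g$ its co-analytic part; its dilatation is $\omega=g'/h'$. $S_H$ is the class of all harmonic, sense-preserving and univalent mappings $f=h+\overline g$ in $E$ normalized by $h(0)=0$ and $h_z(0)=1$, so that $f(z)=z+\sum_{k=2}^\infty a_kz^k+\sum_{k=1}^\infty\overline{b_kz^k}$. $K_H$ is the subclass of $S_H$ of functions mapping $E$ onto convex domains. The convolution (Hadamard product) of $F=H+\overline G=z+\sum_{k=2}^\infty A_kz^k+\sum_{k=1}^\infty\overline{B_k}\,\overline z^k$ and $f=h+\overline g=z+\sum_{k=2}^\infty a_kz^k+\sum_{k=1}^\infty\overline{b_k}\,\overline z^k$ is $F\ast f=(H\ast h)+\overline{(G\ast g)}$, obtained by multiplying corresponding coefficients: $(F\ast f)(z)=z+\sum_{k=2}^\infty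 a_kA_kz^k+\sum_{k=1}^\infty\overline{b_kB_k}\,\overline z^k$. A domain is convex in the horizontal direction (CHD) if every line parallel to the real axis has a connected intersection with it; a mapping is called CHD if its image of $E$ is such a domain. The mapping $f_a$ satisfies $h_a+g_a=\frac{z}{1-z}$ and has dilatation $\frac{a-z}{1-az}$.
   Formalization: Since f_a, f_b and f_a∗f_b have h'(0) equal to 1/(1+a), 1/(1+b) and 1/((1+a)(1+b)) rather than 1, membership in K_H and S_H is stated for (1+a)f_a, (1+b)f_b and (1+a)(1+b)(f_a∗f_b); CHD is stated for f_a∗f_b itself. *)

theory Defs
  imports "HOL-Complex_Analysis.Complex_Analysis"
begin

abbreviation unit_disk :: "complex set" where
  "unit_disk \<equiv> ball 0 1"

text \<open>
  A harmonic mapping \<open>f = h + cnj g\<close> of the unit disk is represented by the pair \<open>(h, g)\<close> of its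
  analytic and co-analytic parts. With \<open>g 0 = 0\<close>, which is part of the classes below, the pair
  is uniquely determined by \<open>f\<close> on the disk.
\<close>

type_synonym harmonic = "(complex \<Rightarrow> complex) \<times> (complex \<Rightarrow> complex)"

definition hmap :: "harmonic \<Rightarrow> complex \<Rightarrow> complex" where
  "hmap f z = fst f z + cnj (snd f z)"

definition dilatation :: "harmonic \<Rightarrow> complex \<Rightarrow> complex" where
  "dilatation f z = deriv (snd f) z / deriv (fst f) z"

text \<open>The determinant of the real derivative of \<open>h + cnj g\<close>, see \<open>hmap_jacobian\<close> below.\<close>

definition hjacobian :: "harmonic \<Rightarrow> complex \<Rightarrow> real" where
  "hjacobian f z = (cmod (deriv (fst f) z))\<^sup>2 - (cmod (deriv (snd f) z))\<^sup>2"

definition sense_preserving :: "harmonic \<Rightarrow> bool" where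
  "sense_preserving f \<longleftrightarrow> (\<forall>z\<in>unit_disk. hjacobian f z > 0)"

definition univalent :: "harmonic \<Rightarrow> bool" where
  "univalent f \<longleftrightarrow> inj_on (hmap f) unit_disk"

definition S_H :: "harmonic set" where
  "S_H = {f. fst f holomorphic_on unit_disk \<and> snd f holomorphic_on unit_disk \<and>
             sense_preserving f \<and> univalent f \<and>
             fst f 0 = 0 \<and> snd f 0 = 0 \<and> deriv (fst f) 0 = 1}"

definition complex_domain :: "complex set \<Rightarrow> bool" where
  "complex_domain D \<longleftrightarrow> D \<noteq> {} \<and> open D \<and> connected D"

definition K_H :: "harmonic set" where
  "K_H = {f \<in> S_H. complex_domain (hmap f ` unit_disk) \<and> convex (hmap f ` unit_disk)}"

text \<open>The empty set counts as connected, so lines missing the domain impose no condition.\<close>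

definition CHD_domain :: "complex set \<Rightarrow> bool" where
  "CHD_domain D \<longleftrightarrow> complex_domain D \<and> (\<forall>y::real. connected (D \<inter> {w. Im w = y}))"

definition CHD :: "harmonic \<Rightarrow> bool" where
  "CHD f \<longleftrightarrow> CHD_domain (hmap f ` unit_disk)"

definition hadamard :: "(complex \<Rightarrow> complex) \<Rightarrow> (complex \<Rightarrow> complex) \<Rightarrow> complex \<Rightarrow> complex" where
  "hadamard F f z =
     (\<Sum>n. fps_nth (fps_expansion F 0) n * fps_nth (fps_expansion f 0) n * z ^ n)"

definition harmonic_conv :: "harmonic \<Rightarrow> harmonic \<Rightarrow> harmonic" where
  "harmonic_conv F f = (hadamard (fst F) (fst f), hadamard (snd F) (snd f))"

text \<open>Multiplication by a real factor acts on \<open>h\<close> and \<open>g\<close> alike.\<close>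

definition hscale :: "real \<Rightarrow> harmonic \<Rightarrow> harmonic" where
  "hscale r f = (\<lambda>z. of_real r * fst f z, \<lambda>z. of_real r * snd f z)"

definition half_plane_map :: "real \<Rightarrow> harmonic" where
  "half_plane_map a =
     (\<lambda>z. (1 / (1 + of_real a) * z - 1 / 2 * z\<^sup>2) / (1 - z)\<^sup>2,
      \<lambda>z. (of_real a / (1 + of_real a) * z - 1 / 2 * z\<^sup>2) / (1 - z)\<^sup>2)"

lemma hmap_hscale: "hmap (hscale r f) z = of_real r * hmap f z"
  by (simp add: hmap_def hscale_def algebra_simps)

lemma hmap_jacobian:
  assumes "fst f holomorphic_on unit_disk" "snd f holomorphic_on unit_disk" "z \<in> unit_disk"
  obtains D where "(hmap f has_derivative D) (at z)"
    and "hjacobian f z = Re (D 1) * Im (D \<i>) - Im (D 1) * Re (D \<i>)"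
proof -
  let ?D = "\<lambda>x. deriv (fst f) z * x + cnj (deriv (snd f) z * x)"
  have "(fst f has_field_derivative deriv (fst f) z) (at z)"
       "(snd f has_field_derivative deriv (snd f) z) (at z)"
    using assms by (auto intro: holomorphic_derivI[OF _ open_ball])
  then have "((\<lambda>x. fst f x + cnj (snd f x)) has_derivative ?D) (at z)"
    unfolding has_field_derivative_def
    by (intro has_derivative_add bounded_linear.has_derivative[OF bounded_linear_cnj]) auto
  then have "(hmap f has_derivative ?D) (at z)"
    by (simp add: hmap_def[abs_def])
  moreover have "hjacobian f z = Re (?D 1) * Im (?D \<i>) - Im (?D 1) * Re (?D \<i>)"
    unfolding hjacobian_def cmod_power2 by (simp add: algebra_simps power2_eq_square)
  ultimately show thesis by (rule that)
qed

text \<open>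
  The mappings \<open>f\<^sub>a\<close> have \<open>h'(0) = 1 / (1 + a)\<close>, hence it is the multiple \<open>(1 + a) f\<^sub>a\<close>
  that satisfies the normalization \<open>h'(0) = 1\<close> of \<open>S_H\<close>. Likewise the conditions
  \<open>h + g = z / (1 - z)\<close> and \<open>g' / h' = (b - z) / (1 - b z)\<close> force \<open>h'(0) = 1 / (1 + b)\<close>, and the
  convolution of the two mappings has \<open>h'(0) = 1 / ((1 + a) (1 + b))\<close>. The lemmas below show that
  the half-plane mappings meet these conditions, and that \<open>(1 + a) f\<^sub>a\<close> does belong to \<open>K_H\<close>.
\<close>

lemma half_plane_term_deriv:
  fixes s z :: complex
  assumes z: "1 - z \<noteq> 0"
  shows "((\<lambda>z. (s * z - 1 / 2 * z\<^sup>2) / (1 - z)\<^sup>2) has_field_derivative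
            (s + s * z - z) / (1 - z) ^ 3) (at z)"
proof -
  have "((\<lambda>z. s * z - 1 / 2 * z\<^sup>2) has_field_derivative (s - z)) (at z)"
    by (auto intro!: derivative_eq_intros)
  moreover have "((\<lambda>z. (1 - z)\<^sup>2) has_field_derivative (- 2 * (1 - z))) (at z)"
    by (auto intro!: derivative_eq_intros)
  ultimately have "((\<lambda>z. (s * z - 1 / 2 * z\<^sup>2) / (1 - z)\<^sup>2) has_field_derivative
      ((s - z) * (1 - z)\<^sup>2 - (s * z - 1 / 2 * z\<^sup>2) * (- 2 * (1 - z))) / ((1 - z)\<^sup>2 * (1 - z)\<^sup>2)) (at z)"
    by (rule DERIV_divide) (use z in simp)
  moreover have "(s - z) * (1 - z)\<^sup>2 - (s * z - 1 / 2 * z\<^sup>2) * (- 2 * (1 - z)) =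
      (1 - z) * (s + s * z - z)"
    by (simp add: power2_eq_square algebra_simps)
  moreover have "(1 - z) * (s + s * z - z) / ((1 - z)\<^sup>2 * (1 - z)\<^sup>2) = (s + s * z - z) / (1 - z) ^ 3"
    using z by (simp add: power2_eq_square power3_eq_cube)
  ultimately show ?thesis by simp
qed

lemma half_plane_deriv:
  fixes a :: real
  assumes a: "\<bar>a\<bar> < 1" and z: "z \<in> unit_disk"
  shows "(fst (half_plane_map a) has_field_derivative
            (1 - of_real a * z) / (1 + of_real a) / (1 - z) ^ 3) (at z)"
    and "(snd (half_plane_map a) has_field_derivative
            (of_real a - z) / (1 + of_real a) / (1 - z) ^ 3) (at z)"
proof -
  have z1: "1 - z \<noteq> 0" using z by auto
  have "(1 + of_real a :: complex) = of_real (1 + a)" by simp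
  then have a1: "(1 + of_real a :: complex) \<noteq> 0" using a by (simp only: of_real_eq_0_iff)
  let ?s = "1 / (1 + of_real a) :: complex" and ?t = "of_real a / (1 + of_real a) :: complex"
  have "?s + ?s * z - z = (1 - of_real a * z) / (1 + of_real a)"
       "?t + ?t * z - z = (of_real a - z) / (1 + of_real a)"
  proof -
    have "z = (1 + of_real a) * z / (1 + of_real a)" using a1 by simp
    then have z': "z = (z + of_real a * z) / (1 + of_real a)" by (simp only: distrib_right mult_1)
    have *: "?s + ?s * z - (z + of_real a * z) / (1 + of_real a) = (1 - of_real a * z) / (1 + of_real a)"
         "?t + ?t * z - (z + of_real a * z) / (1 + of_real a) = (of_real a - z) / (1 + of_real a)"
      unfolding times_divide_eq_left mult_1 add_divide_distrib[symmetric] diff_divide_distrib[symmetric]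
      by (rule arg_cong2[where f = "(/)"]; simp)+
    show "?s + ?s * z - z = (1 - of_real a * z) / (1 + of_real a)"
         "?t + ?t * z - z = (of_real a - z) / (1 + of_real a)"
      by (rule *[unfolded z'[symmetric]])+
  qed
  with half_plane_term_deriv[OF z1, of ?s] half_plane_term_deriv[OF z1, of ?t]
  show "(fst (half_plane_map a) has_field_derivative
            (1 - of_real a * z) / (1 + of_real a) / (1 - z) ^ 3) (at z)"
    and "(snd (half_plane_map a) has_field_derivative
            (of_real a - z) / (1 + of_real a) / (1 - z) ^ 3) (at z)"
    unfolding half_plane_map_def fst_conv snd_conv by (simp_all only:)
qed

lemma half_plane_sum:
  fixes a :: real
  assumes a: "\<bar>a\<bar> < 1" and z: "z \<in> unit_disk"
  shows "fst (half_plane_map a) z + snd (half_plane_map a) z = z / (1 - z)"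
proof -
  have z1: "1 - z \<noteq> 0" using z by auto
  have "(1 + of_real a :: complex) = of_real (1 + a)" by simp
  then have a1: "(1 + of_real a :: complex) \<noteq> 0" using a by (simp only: of_real_eq_0_iff)
  have "1 / (1 + of_real a) + of_real a / (1 + of_real a) = (1 :: complex)"
    using a1 by (simp add: add_divide_distrib[symmetric])
  then have "1 / (1 + of_real a) * z + of_real a / (1 + of_real a) * z = z"
    by (simp only: distrib_right[symmetric] mult_1)
  then have "fst (half_plane_map a) z + snd (half_plane_map a) z = (z - z\<^sup>2) / (1 - z)\<^sup>2"
    unfolding half_plane_map_def fst_conv snd_conv add_divide_distrib[symmetric]
    by (simp add: algebra_simps)
  also have "z - z\<^sup>2 = z * (1 - z)" by (simp add: power2_eq_square algebra_simps)
  finally show ?thesis using z1 by (simp add: power2_eq_square)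
qed

lemma half_plane_dilatation:
  fixes a :: real
  assumes a: "\<bar>a\<bar> < 1" and z: "z \<in> unit_disk"
  shows "dilatation (half_plane_map a) z = (of_real a - z) / (1 - of_real a * z)"
proof -
  have z1: "1 - z \<noteq> 0" using z by auto
  have "(1 + of_real a :: complex) = of_real (1 + a)" by simp
  then have a1: "(1 + of_real a :: complex) \<noteq> 0" using a by (simp only: of_real_eq_0_iff)
  show ?thesis
    unfolding dilatation_def half_plane_deriv[OF a z, THEN DERIV_imp_deriv]
    using z1 a1 by simp
qed

text \<open>With \<open>w = z / (1 - z)\<close>, the half-plane mapping is a shear of \<open>w\<close>.\<close>

lemma half_plane_shear:
  fixes a :: real
  assumes a: "\<bar>a\<bar> < 1" and w: "1 + w \<noteq> 0"
  shows "hmap (half_plane_map a) (w / (1 + w)) =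
           Complex (Re w) ((1 - a) / (1 + a) * Im w * (1 + 2 * Re w))"
proof -
  define c where "c = (1 - a) / (1 + a)"
  have "1 / (1 + a) + a / (1 + a) = (1 + a) / (1 + a)" by (rule add_divide_distrib[symmetric])
  also have "\<dots> = 1" using a by simp
  finally have "1 / (1 + a) + a / (1 + a) = 1" .
  moreover have "c = 1 / (1 + a) - a / (1 + a)" unfolding c_def by (rule diff_divide_distrib)
  moreover have "p = (1 + c) / 2 \<and> q = (1 - c) / 2" if "p + q = 1" "c = p - q" for p q
    using that by auto
  ultimately have c: "1 / (1 + a) = (1 + c) / 2" "a / (1 + a) = (1 - c) / 2"
    by blast+
  have "1 / (1 + of_real a) = (of_real (1 / (1 + a)) :: complex)"
       "of_real a / (1 + of_real a) = (of_real (a / (1 + a)) :: complex)" by simp_all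
  then have cc: "1 / (1 + of_real a) = (1 + of_real c :: complex) / 2"
       "of_real a / (1 + of_real a) = (1 - of_real c :: complex) / 2"
    by (simp_all add: c)
  have q: "1 - w / (1 + w) = 1 / (1 + w)" using w by (simp add: field_simps)
  have k: "(x * (w / (1 + w)) - 1 / 2 * (w / (1 + w))\<^sup>2) / (1 / (1 + w))\<^sup>2 =
            x * w * (1 + w) - w\<^sup>2 / 2" for x
  proof -
    have "x * (w / (1 + w)) - 1 / 2 * (w / (1 + w))\<^sup>2 = (x * w * (1 + w) - w\<^sup>2 / 2) / (1 + w)\<^sup>2"
      using w by (simp add: power2_eq_square diff_divide_distrib)
    then show ?thesis using w by (simp add: power_divide)
  qed
  have "hmap (half_plane_map a) (w / (1 + w)) =
     (1 + of_real c) / 2 * w * (1 + w) - w\<^sup>2 / 2 + cnj ((1 - of_real c) / 2 * w * (1 + w) - w\<^sup>2 / 2)"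
    unfolding hmap_def half_plane_map_def fst_conv snd_conv q k cc ..
  also have "\<dots> = Complex (Re w) (c * Im w * (1 + 2 * Re w))"
    by (simp add: complex_eq_iff power2_eq_square field_simps)
  finally show ?thesis by (simp add: c_def)
qed

lemma half_plane_param:
  "(\<lambda>w. w / (1 + w)) ` {w. Re w > - 1 / 2} = unit_disk" (is "?T ` ?P = _")
proof -
  have iff: "cmod w < cmod (1 + w) \<longleftrightarrow> Re w > - 1 / 2" for w
  proof -
    have "cmod w < cmod (1 + w) \<longleftrightarrow> (cmod w)\<^sup>2 < (cmod (1 + w))\<^sup>2"
      using abs_le_square_iff[of "cmod (1 + w)" "cmod w"] unfolding abs_norm_cancel by linarith
    also have "\<dots> \<longleftrightarrow> Re w > - 1 / 2"
      unfolding cmod_power2 by (auto simp: power2_eq_square algebra_simps)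
    finally show ?thesis .
  qed
  have "?T w \<in> unit_disk" if "w \<in> ?P" for w
  proof -
    have "cmod w < cmod (1 + w)" using that by (simp add: iff)
    moreover from this have "cmod (1 + w) > 0" using norm_ge_zero[of w] by linarith
    ultimately show ?thesis by (simp add: norm_divide divide_simps)
  qed
  moreover have "z \<in> ?T ` ?P" if z: "z \<in> unit_disk" for z
  proof
    have z1: "1 - z \<noteq> 0" using z by auto
    then have e: "1 + z / (1 - z) = 1 / (1 - z)" by (simp add: field_simps)
    show "z = ?T (z / (1 - z))" unfolding e using z1 by simp
    have "cmod (z / (1 - z)) < cmod (1 + z / (1 - z))"
      unfolding e using z z1 by (simp add: norm_divide divide_simps)
    then show "z / (1 - z) \<in> ?P" by (simp add: iff)
  qed
  ultimately show ?thesis by blast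
qed

lemma half_plane_univalent:
  fixes a :: real
  assumes a: "\<bar>a\<bar> < 1"
  shows "inj_on (hmap (half_plane_map a)) unit_disk"
    and "hmap (half_plane_map a) ` unit_disk = {w. Re w > - 1 / 2}"
proof -
  let ?f = "hmap (half_plane_map a)" and ?P = "{w. Re w > - 1 / 2}" and ?T = "\<lambda>w::complex. w / (1 + w)"
  define c where "c = (1 - a) / (1 + a)"
  have c: "c > 0" using a by (auto simp: c_def)
  have sh: "?f (?T w) = Complex (Re w) (c * Im w * (1 + 2 * Re w))" if "w \<in> ?P" for w
  proof -
    have "1 + w \<noteq> 0" using that by (auto simp: complex_eq_iff)
    then show ?thesis unfolding c_def by (rule half_plane_shear[OF a])
  qed
  have "w = w'" if "w \<in> ?P" "w' \<in> ?P" "?f (?T w) = ?f (?T w')" for w w'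
    using that(3) c that(1,2) unfolding sh[OF that(1)] sh[OF that(2)]
    by (auto simp: complex_eq_iff)
  then show "inj_on ?f unit_disk"
    unfolding half_plane_param[symmetric] by (auto intro!: inj_onI)
  have "?f (?T w) \<in> ?P" if "w \<in> ?P" for w using that by (simp add: sh)
  moreover have "\<exists>w\<in>?P. y = ?f (?T w)" if y: "y \<in> ?P" for y
  proof
    let ?w = "Complex (Re y) (Im y / (c * (1 + 2 * Re y)))"
    show w: "?w \<in> ?P" using y by simp
    have "1 + 2 * Re y > 0" using y by simp
    then show "y = ?f (?T ?w)" unfolding sh[OF w] using c by (simp add: complex_eq_iff)
  qed
  ultimately show "?f ` unit_disk = ?P"
    unfolding half_plane_param[symmetric] by blast
qed

lemma half_plane_map_K_H:
  fixes a :: real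
  assumes a: "\<bar>a\<bar> < 1"
  shows "hscale (1 + a) (half_plane_map a) \<in> K_H"
proof -
  let ?f = "hscale (1 + a) (half_plane_map a)"
  have "(1 + of_real a :: complex) = of_real (1 + a)" by simp
  then have a1: "(1 + of_real a :: complex) \<noteq> 0" using a by (simp only: of_real_eq_0_iff)
  have d: "(fst ?f has_field_derivative (1 - of_real a * z) / (1 - z) ^ 3) (at z)"
          "(snd ?f has_field_derivative (of_real a - z) / (1 - z) ^ 3) (at z)"
    if z: "z \<in> unit_disk" for z
    using half_plane_deriv[OF a z, THEN DERIV_cmult, of "of_real (1 + a)"] a1
    by (simp_all add: hscale_def)
  have hol: "fst ?f holomorphic_on unit_disk" "snd ?f holomorphic_on unit_disk"
    unfolding holomorphic_on_open[OF open_ball] using d by blast+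
  have "hjacobian ?f z > 0" if z: "z \<in> unit_disk" for z
  proof -
    have z1: "1 - z \<noteq> 0" using z by auto
    have z2: "(cmod z)\<^sup>2 < 1" using z by (simp add: power_less_one_iff abs_square_less_1)
    have a2: "a\<^sup>2 < 1" using a by (simp add: abs_square_less_1)
    have "(cmod (1 - of_real a * z))\<^sup>2 - (cmod (of_real a - z))\<^sup>2 = (1 - a\<^sup>2) * (1 - (cmod z)\<^sup>2)"
      unfolding cmod_power2 by (simp add: power2_eq_square algebra_simps)
    also have "\<dots> > 0" using z2 a2 by simp
    finally have p: "(cmod (1 - of_real a * z))\<^sup>2 > (cmod (of_real a - z))\<^sup>2" by simp
    have "hjacobian ?f z =
        ((cmod (1 - of_real a * z))\<^sup>2 - (cmod (of_real a - z))\<^sup>2) / (cmod ((1 - z) ^ 3))\<^sup>2"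
      unfolding hjacobian_def d[OF z, THEN DERIV_imp_deriv] norm_divide power_divide
      by (simp add: diff_divide_distrib)
    also have "\<dots> > 0" using p z1 by (intro divide_pos_pos) auto
    finally show ?thesis .
  qed
  then have sp: "sense_preserving ?f" by (simp add: sense_preserving_def)
  have a0: "1 + a \<noteq> 0" "1 + a > 0" using a by auto
  have hm: "hmap ?f = (\<lambda>w. of_real (1 + a) * w) \<circ> hmap (half_plane_map a)"
    by (simp add: fun_eq_iff hmap_hscale)
  have uni: "univalent ?f"
    unfolding univalent_def hm
    by (rule comp_inj_on[OF half_plane_univalent(1)[OF a]]) (use a1 in \<open>auto intro!: inj_onI\<close>)
  have im: "hmap ?f ` unit_disk = (\<lambda>w. (1 + a) *\<^sub>R w) ` {w. Re w > - 1 / 2}"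
    unfolding hm image_comp[symmetric] half_plane_univalent(2)[OF a] by (simp add: scaleR_conv_of_real)
  have cv: "convex {w. Re w > - 1 / 2}" and op: "open {w. Re w > - 1 / 2}"
    by (simp_all add: convex_halfspace_Re_gt open_halfspace_Re_gt)
  have cv': "convex (hmap ?f ` unit_disk)" unfolding im by (rule convex_scaling[OF cv])
  have op': "open (hmap ?f ` unit_disk)" unfolding im by (rule open_scaling[OF a0(1) op])
  have z0: "(0 :: complex) \<in> unit_disk" by simp
  have n: "fst ?f 0 = 0" "snd ?f 0 = 0" "deriv (fst ?f) 0 = 1"
    using d(1)[OF z0, THEN DERIV_imp_deriv] by (simp_all add: hscale_def half_plane_map_def)
  have "hmap ?f ` unit_disk \<noteq> {}" by simp
  then show ?thesis
    using hol sp uni n cv' op' convex_connected[OF cv']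
    by (simp add: K_H_def S_H_def complex_domain_def)
qed

end

theory Submission
  imports Defs
begin

text \<open>
  Write \<open>c = (1 - a) / (1 + a)\<close> and \<open>d = (1 - b) / (1 + b)\<close>. The coefficients of \<open>f\<^sub>a\<close> are
  \<open>(1 \<plusminus> c n) / 2\<close>, so those of the convolution are \<open>(1 \<plusminus> (c + d) n + c d n\<^sup>2) / 4\<close>, and the
  hypothesis on \<open>b\<close> says exactly that \<open>c d \<le> 2\<close>. In the coordinate \<open>p = (1 + z) / (1 - z)\<close>, which
  maps the disk onto \<open>Re p > 0\<close>, the three power series involved are polynomials in \<open>p\<close>. With
  \<open>p = u + i v\<close> and \<open>t = u v\<close>, the imaginary part of the convolution is \<open>(c + d) t / 4\<close>, while for fixed
  \<open>t\<close> its real part is strictly increasing in \<open>u > 0\<close>. This gives both univalence and the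
  connectedness of the horizontal slices.
\<close>

section \<open>The Cayley coordinate on the disk\<close>

definition cayley :: "complex \<Rightarrow> complex" where
  "cayley z = (1 + z) / (1 - z)"

lemma cayley_0: "cayley 0 = 1"
  by (simp add: cayley_def)

lemma Re_cayley:
  assumes "z \<in> unit_disk"
  shows "Re (cayley z) > 0"
proof -
  have "cmod z < 1" using assms by simp
  then have z2: "(cmod z)\<^sup>2 < 1" by (simp add: power_less_one_iff abs_square_less_1)
  have z1: "1 - z \<noteq> 0" using assms by auto
  have "Re (cayley z) = (1 - (cmod z)\<^sup>2) / (cmod (1 - z))\<^sup>2"
    unfolding cayley_def Re_divide cmod_power2
    by (simp add: power2_eq_square algebra_simps add_divide_distrib diff_divide_distrib)
  also have "\<dots> > 0" using z2 z1 by (intro divide_pos_pos) auto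
  finally show ?thesis .
qed

lemma cayley_inverse:
  assumes "z \<noteq> 1"
  shows "(cayley z - 1) / (cayley z + 1) = z"
proof -
  have "1 - z \<noteq> 0" using assms by simp
  then have "cayley z - 1 = 2 * z / (1 - z)" "cayley z + 1 = 2 / (1 - z)"
    by (simp_all add: cayley_def field_simps)
  with \<open>1 - z \<noteq> 0\<close> show ?thesis by simp
qed

lemma inj_on_cayley: "inj_on cayley unit_disk"
proof (rule inj_on_inverseI)
  show "(cayley z - 1) / (cayley z + 1) = z" if "z \<in> unit_disk" for z
    using that by (intro cayley_inverse) auto
qed

lemma cayley_image: "cayley ` unit_disk = {p. Re p > 0}"
proof (intro equalityI subsetI)
  fix p assume "p \<in> {p. Re p > 0}"
  \<comment> \<open>Here w = z / (1 - z) equals (p - 1) / 2, so the half-plane Re w > -1/2 of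
    \<open>half_plane_param\<close> becomes Re p > 0.\<close>
  then have "(p - 1) / 2 \<in> {w. Re w > - 1 / 2}" and p1: "p + 1 \<noteq> 0"
    by (auto simp: complex_eq_iff)
  then have "(p - 1) / 2 / (1 + (p - 1) / 2) \<in> unit_disk"
    using half_plane_param by blast
  moreover have "1 + (p - 1) / 2 = (p + 1) / 2" by (simp add: add_divide_distrib diff_divide_distrib)
  moreover have "(p - 1) / 2 / ((p + 1) / 2) = (p - 1) / (p + 1)"
    by (simp del: divide_divide_eq_right)
  ultimately have d: "(p - 1) / (p + 1) \<in> unit_disk" by (simp only:)
  have "1 + (p - 1) / (p + 1) = 2 * p / (p + 1)" "1 - (p - 1) / (p + 1) = 2 / (p + 1)"
    using p1 by (simp_all add: field_simps)
  then have "cayley ((p - 1) / (p + 1)) = p" using p1 by (simp add: cayley_def)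
  with d show "p \<in> cayley ` unit_disk" by force
qed (use Re_cayley in auto)

lemma cayley_derivative:
  assumes "z \<noteq> 1"
  shows "(cayley has_field_derivative 2 / (1 - z)\<^sup>2) (at z)"
  unfolding cayley_def [abs_def] using assms
  by (auto intro!: derivative_eq_intros simp: power2_eq_square)

text \<open>Read in p, the Euler operator z d/dz is (p^2 - 1)/2 d/dp. It multiplies the n-th Taylor
  coefficient by n, so each factor n in a coefficient raises the degree in p by one.\<close>

lemma times_cayley_derivative:
  assumes "z \<noteq> 1"
  shows "z * (2 / (1 - z)\<^sup>2) = ((cayley z)\<^sup>2 - 1) / 2"
proof -
  have "(cayley z)\<^sup>2 - 1 = ((1 + z)\<^sup>2 - (1 - z)\<^sup>2) / (1 - z)\<^sup>2"
    using assms by (simp add: cayley_def power_divide diff_divide_distrib)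
  also have "(1 + z)\<^sup>2 - (1 - z)\<^sup>2 = 4 * z" by (simp add: power2_eq_square algebra_simps)
  finally show ?thesis by simp
qed

section \<open>Power series that are polynomials in the Cayley coordinate\<close>

lemma sums_times_index:
  fixes c :: "nat \<Rightarrow> complex"
  assumes "\<And>z. norm z < K \<Longrightarrow> (\<lambda>n. c n * z ^ n) sums f z"
    and "(f has_field_derivative f') (at z)" and "norm z < K"
  shows "(\<lambda>n. of_nat n * c n * z ^ n) sums (z * f')"
proof -
  have "(\<lambda>n. z * (diffs c n * z ^ n)) sums (z * f')"
    by (intro sums_mult termdiffs_sums_strong[OF assms])
  then have "(\<lambda>n. of_nat (Suc n) * c (Suc n) * z ^ Suc n) sums (z * f')"
    by (simp add: diffs_def algebra_simps)
  \<comment> \<open>The index shift changes nothing, since the term at n = 0 carries the factor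
    0.\<close>
  then show ?thesis
    by (subst (asm) sums_Suc_iff) simp
qed

text \<open>The sum is z / (1 - z), a geometric series without its constant term. The factor
  \<open>of_bool\<close> keeps that term out later as well, where \<alpha> + \<beta> n need not
  vanish at n = 0.\<close>

lemma cayley_series_0:
  assumes "cmod z < 1"
  shows "(\<lambda>n. of_bool (n > 0) * z ^ n) sums ((cayley z - 1) / 2)"
proof -
  have "(\<lambda>n. z * z ^ n) sums (z * (1 / (1 - z)))"
    by (intro sums_mult geometric_sums assms)
  moreover have "1 - z \<noteq> 0" using assms by auto
  then have "z * (1 / (1 - z)) = (cayley z - 1) / 2"
    by (simp add: cayley_def field_simps)
  moreover have "of_bool (Suc n > 0) * z ^ Suc n = z * z ^ n" for n by simp
  ultimately have "(\<lambda>n. of_bool (Suc n > 0) * z ^ Suc n) sums ((cayley z - 1) / 2)"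
    by (simp only:)
  then show ?thesis by (subst (asm) sums_Suc_iff) simp
qed

lemma cayley_series_1:
  assumes "cmod z < 1"
  shows "(\<lambda>n. of_nat n * z ^ n) sums (((cayley z)\<^sup>2 - 1) / 4)"
proof -
  have z: "z \<noteq> 1" using assms by auto
  have "((\<lambda>z. (cayley z - 1) / 2) has_field_derivative 2 / (1 - z)\<^sup>2 / 2) (at z)"
    by (auto intro!: derivative_eq_intros cayley_derivative[OF z])
  from sums_times_index[OF cayley_series_0 this assms]
  have "(\<lambda>n. of_nat n * of_bool (n > 0) * z ^ n) sums (z * (2 / (1 - z)\<^sup>2 / 2))" by simp
  moreover have "z * (2 / (1 - z)\<^sup>2 / 2) = ((cayley z)\<^sup>2 - 1) / 4"
    unfolding times_divide_eq_right times_cayley_derivative[OF z, unfolded times_divide_eq_right]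
    by simp
  moreover have "of_nat n * of_bool (n > 0) = (of_nat n :: complex)" for n by (cases n) auto
  ultimately show ?thesis by (simp only:)
qed

lemma cayley_series_2:
  assumes "cmod z < 1"
  shows "(\<lambda>n. (of_nat n)\<^sup>2 * z ^ n) sums (cayley z * ((cayley z)\<^sup>2 - 1) / 4)"
proof -
  have z: "z \<noteq> 1" using assms by auto
  have "((\<lambda>z. ((cayley z)\<^sup>2 - 1) / 4) has_field_derivative (cayley z * (2 / (1 - z)\<^sup>2)) / 2) (at z)"
    by (auto intro!: derivative_eq_intros cayley_derivative[OF z])
  from sums_times_index[OF cayley_series_1 this assms]
  have "(\<lambda>n. (of_nat n)\<^sup>2 * z ^ n) sums (z * ((cayley z * (2 / (1 - z)\<^sup>2)) / 2))"
    by (simp add: power2_eq_square)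
  moreover have "z * ((cayley z * (2 / (1 - z)\<^sup>2)) / 2) = cayley z * (z * (2 / (1 - z)\<^sup>2)) / 2"
    by simp
  moreover have "\<dots> = cayley z * ((cayley z)\<^sup>2 - 1) / 4"
    unfolding times_cayley_derivative[OF z] by simp
  ultimately show ?thesis by (simp only:)
qed

text \<open>The function with Taylor coefficients \<alpha> + \<beta> n + \<gamma> n^2 for n \<ge> 1,
  written in p: the three summands are built from z / (1 - z) and its first two images under z
  d/dz.\<close>

definition cayley_cubic :: "complex \<Rightarrow> complex \<Rightarrow> complex \<Rightarrow> complex \<Rightarrow> complex" where
  "cayley_cubic \<alpha> \<beta> \<gamma> p = \<alpha> * (p - 1) / 2 + \<beta> * (p\<^sup>2 - 1) / 4 + \<gamma> * p * (p\<^sup>2 - 1) / 4"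

lemma cayley_cubic_sums:
  assumes "cmod z < 1"
  shows "(\<lambda>n. of_bool (n > 0) * (\<alpha> + \<beta> * of_nat n + \<gamma> * (of_nat n)\<^sup>2) * z ^ n)
           sums cayley_cubic \<alpha> \<beta> \<gamma> (cayley z)"
proof -
  have "(\<lambda>n. \<alpha> * (of_bool (n > 0) * z ^ n) + \<beta> * (of_nat n * z ^ n) + \<gamma> * ((of_nat n)\<^sup>2 * z ^ n))
     sums (\<alpha> * ((cayley z - 1) / 2) + \<beta> * (((cayley z)\<^sup>2 - 1) / 4) + \<gamma> * (cayley z * ((cayley z)\<^sup>2 - 1) / 4))"
    by (intro sums_add sums_mult cayley_series_0 cayley_series_1 cayley_series_2 assms)
  moreover have "\<alpha> * (of_bool (n > 0) * z ^ n) + \<beta> * (of_nat n * z ^ n) + \<gamma> * ((of_nat n)\<^sup>2 * z ^ n) =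
      of_bool (n > 0) * (\<alpha> + \<beta> * of_nat n + \<gamma> * (of_nat n)\<^sup>2) * z ^ n" for n
    by (cases n) (auto simp: algebra_simps)
  ultimately show ?thesis
    unfolding cayley_cubic_def by (simp only: times_divide_eq_right mult.assoc)
qed

section \<open>Hadamard products from explicit coefficients\<close>

lemma fps_nth_expansion_sums:
  assumes "\<And>z. z \<in> unit_disk \<Longrightarrow> (\<lambda>n. c n * z ^ n) sums f z"
  shows "fps_nth (fps_expansion f 0) n = c n"
proof -
  have "f has_fps_expansion Abs_fps c"
  proof (rule has_fps_expansionI)
    have "eventually (\<lambda>z. z \<in> unit_disk) (nhds 0)" by (rule eventually_nhds_in_open) auto
    then show "eventually (\<lambda>z. (\<lambda>n. fps_nth (Abs_fps c) n * z ^ n) sums f z) (nhds 0)"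
      by (rule eventually_mono) (simp add: assms)
  qed
  then show ?thesis by (simp add: fps_expansion_eqI)
qed

text \<open>Uniqueness of Taylor coefficients identifies those hidden in \<open>hadamard\<close>
  with A and B; the third assumption supplies the convergence that gives the infinite sum its
  value.\<close>

lemma hadamard_sums:
  assumes "\<And>z. z \<in> unit_disk \<Longrightarrow> (\<lambda>n. A n * z ^ n) sums F z"
    and "\<And>z. z \<in> unit_disk \<Longrightarrow> (\<lambda>n. B n * z ^ n) sums f z"
    and "(\<lambda>n. A n * B n * z ^ n) sums s"
  shows "hadamard F f z = s"
proof -
  have "fps_nth (fps_expansion F 0) n = A n" "fps_nth (fps_expansion f 0) n = B n" for n
    using assms(1,2) by (blast intro: fps_nth_expansion_sums)+
  then show ?thesis
    using sums_unique[OF assms(3)] by (simp add: hadamard_def)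
qed

lemma hadamard_cayley_linear:
  assumes F: "\<And>z. z \<in> unit_disk \<Longrightarrow> F z = cayley_cubic (1 / 2) (\<beta> / 2) 0 (cayley z)"
    and f: "\<And>z. z \<in> unit_disk \<Longrightarrow> f z = cayley_cubic (1 / 2) (\<beta>' / 2) 0 (cayley z)"
    and z: "z \<in> unit_disk"
  shows "hadamard F f z = cayley_cubic (1 / 4) ((\<beta> + \<beta>') / 4) (\<beta> * \<beta>' / 4) (cayley z)"
proof -
  let ?A = "\<lambda>\<alpha> \<beta> \<gamma> n. of_bool (n > 0) * (\<alpha> + \<beta> * of_nat n + \<gamma> * (of_nat n)\<^sup>2) :: complex"
  show ?thesis
  proof (rule hadamard_sums)
    show "(\<lambda>n. ?A (1 / 2) (\<beta> / 2) 0 n * z ^ n) sums F z"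
      and "(\<lambda>n. ?A (1 / 2) (\<beta>' / 2) 0 n * z ^ n) sums f z" if "z \<in> unit_disk" for z
      unfolding F[OF that] f[OF that] by (intro cayley_cubic_sums; use that in simp)+
    \<comment> \<open>For n \<ge> 1 this is (1 + \<beta> n)/2 times (1 + \<beta>' n)/2; at n = 0
      both sides vanish.\<close>
    have "?A (1 / 2) (\<beta> / 2) 0 n * ?A (1 / 2) (\<beta>' / 2) 0 n =
        ?A (1 / 4) ((\<beta> + \<beta>') / 4) (\<beta> * \<beta>' / 4) n" for n
      by (cases n) (simp_all add: field_simps power2_eq_square)
    then show "(\<lambda>n. ?A (1 / 2) (\<beta> / 2) 0 n * ?A (1 / 2) (\<beta>' / 2) 0 n * z ^ n)
        sums cayley_cubic (1 / 4) ((\<beta> + \<beta>') / 4) (\<beta> * \<beta>' / 4) (cayley z)"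
      using cayley_cubic_sums[of z] z by (simp only: mem_ball_0)
  qed
qed

section \<open>The half-plane mappings, and recovery of a pair from its sum and dilatation\<close>

lemma half_plane_map_cayley:
  fixes a :: real
  assumes a: "\<bar>a\<bar> < 1" and z: "z \<in> unit_disk"
  defines "c \<equiv> of_real ((1 - a) / (1 + a)) :: complex"
  shows "fst (half_plane_map a) z = cayley_cubic (1 / 2) (c / 2) 0 (cayley z)"
    and "snd (half_plane_map a) z = cayley_cubic (1 / 2) (- c / 2) 0 (cayley z)"
proof -
  have z1: "z \<noteq> 1" using z by auto
  define F G where "F = fst (half_plane_map a) z" and "G = snd (half_plane_map a) z"
  have "F + G = z / (1 - z)"
    unfolding F_def G_def by (rule half_plane_sum[OF a z])
  also have "\<dots> = (cayley z - 1) / 2"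
    using z1 by (simp add: cayley_def field_simps)
  finally have s: "F + G = (cayley z - 1) / 2" .
  \<comment> \<open>The difference is c times the Koebe function z / (1 - z)^2. Together with the
    sum, which does not involve a, it determines both parts.\<close>
  have "F - G = (1 / (1 + of_real a) - of_real a / (1 + of_real a)) * (z / (1 - z)\<^sup>2)"
    unfolding F_def G_def half_plane_map_def fst_conv snd_conv diff_divide_distrib[symmetric]
    by (simp add: diff_divide_distrib left_diff_distrib)
  also have "1 / (1 + of_real a) - of_real a / (1 + of_real a) = c"
    unfolding c_def by (simp add: diff_divide_distrib)
  also have "z / (1 - z)\<^sup>2 = ((cayley z)\<^sup>2 - 1) / 4"
    using times_cayley_derivative[OF z1] by (simp add: mult.commute)
  finally have d: "F - G = c * (((cayley z)\<^sup>2 - 1) / 4)" .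
  have "F = ((F + G) + (F - G)) / 2" "G = ((F + G) - (F - G)) / 2" by simp_all
  then show "F = cayley_cubic (1 / 2) (c / 2) 0 (cayley z)"
    and "G = cayley_cubic (1 / 2) (- c / 2) 0 (cayley z)"
    unfolding s d by (simp_all add: cayley_cubic_def add_divide_distrib diff_divide_distrib)
qed

text \<open>Differentiating the sum condition and inserting g' = \<omega> h' gives h' (1 + \<omega>)
  = 1 / (1 - z)^2. This fixes h', then h by its value at 0, then g by the sum.\<close>

lemma half_plane_map_unique:
  assumes b: "\<bar>b\<bar> < 1"
    and h: "h holomorphic_on unit_disk" and g: "g holomorphic_on unit_disk"
    and h0: "h 0 = 0" and h': "\<And>z. z \<in> unit_disk \<Longrightarrow> deriv h z \<noteq> 0"
    and sum: "\<And>z. z \<in> unit_disk \<Longrightarrow> h z + g z = z / (1 - z)"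
    and dil: "\<And>z. z \<in> unit_disk \<Longrightarrow> dilatation (h, g) z = (of_real b - z) / (1 - of_real b * z)"
    and z: "z \<in> unit_disk"
  shows "h z = fst (half_plane_map b) z" and "g z = snd (half_plane_map b) z"
proof -
  have D: "(h has_field_derivative (1 - of_real b * z) / (1 + of_real b) / (1 - z) ^ 3) (at z)"
    if z: "z \<in> unit_disk" for z
  proof -
    have z1: "1 - z \<noteq> 0" using z by auto
    have "(1 + of_real b :: complex) = of_real (1 + b)" by simp
    then have b1: "(1 + of_real b :: complex) \<noteq> 0" using b by (simp only: of_real_eq_0_iff)
    have "cmod (of_real b * z) \<le> cmod z"
      using b by (simp add: norm_mult mult_left_le_one_le)
    then have "cmod (of_real b * z) < 1" using z by simp
    then have bz: "1 - of_real b * z \<noteq> 0" by auto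
    have dh: "(h has_field_derivative deriv h z) (at z)"
      and dg: "(g has_field_derivative deriv g z) (at z)"
      using h g z by (auto intro: holomorphic_derivI[OF _ open_ball])
    have "((\<lambda>z. z / (1 - z)) has_field_derivative 1 / (1 - z)\<^sup>2) (at z)"
      using z1 by (auto intro!: derivative_eq_intros simp: power2_eq_square)
    then have "((\<lambda>z. h z + g z) has_field_derivative 1 / (1 - z)\<^sup>2) (at z)"
      by (rule has_field_derivative_transform_within_open[OF _ open_ball z]) (simp add: sum)
    from DERIV_unique[OF DERIV_add[OF dh dg] this]
    have "deriv h z + deriv g z = 1 / (1 - z)\<^sup>2" .
    \<comment> \<open>Since x / 0 = 0, the dilatation would say nothing about
      \<open>deriv g z\<close> at a zero of \<open>deriv h\<close>; nonvanishing of h' allows the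
      quotient to be cleared.\<close>
    moreover have "deriv g z = (of_real b - z) / (1 - of_real b * z) * deriv h z"
      using dil[OF z] h'[OF z] unfolding dilatation_def by (simp add: divide_eq_eq)
    ultimately have "deriv h z * (1 + (of_real b - z) / (1 - of_real b * z)) = 1 / (1 - z)\<^sup>2"
      by (simp add: algebra_simps)
    also have "1 + (of_real b - z) / (1 - of_real b * z) =
        (1 + of_real b) * (1 - z) / (1 - of_real b * z)"
      using bz by (simp add: divide_simps) (simp add: algebra_simps)
    finally have "deriv h z = (1 - of_real b * z) / (1 + of_real b) / (1 - z) ^ 3"
      using bz b1 z1 by (simp add: divide_simps power2_eq_square power3_eq_cube mult_ac)
    with dh show ?thesis by simp
  qed
  have "\<exists>k. \<forall>z\<in>unit_disk. h z - fst (half_plane_map b) z = k"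
  proof (rule has_field_derivative_zero_constant)
    show "((\<lambda>z. h z - fst (half_plane_map b) z) has_field_derivative 0) (at z within unit_disk)"
      if "z \<in> unit_disk" for z
      using DERIV_diff[OF D[OF that] half_plane_deriv(1)[OF b that]]
      by (simp add: has_field_derivative_at_within)
  qed simp
  then obtain k where k: "\<And>z. z \<in> unit_disk \<Longrightarrow> h z - fst (half_plane_map b) z = k" by blast
  from k[of 0] h0 have "k = 0" by (simp add: half_plane_map_def)
  with k[OF z] show hz: "h z = fst (half_plane_map b) z" by simp
  show "g z = snd (half_plane_map b) z"
    using sum[OF z] half_plane_sum[OF b z] unfolding hz by (metis add_left_cancel)
qed

section \<open>Univalence and horizontal convexity in the Cayley coordinate\<close>

lemma has_field_derivative_cayley_cubic:
  assumes z: "z \<noteq> 1"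
  shows "((\<lambda>z. cayley_cubic \<alpha> \<beta> \<gamma> (cayley z)) has_field_derivative
           (\<alpha> / 2 + \<beta> * cayley z / 2 + \<gamma> * (3 * (cayley z)\<^sup>2 - 1) / 4) * (2 / (1 - z)\<^sup>2)) (at z)"
proof (rule DERIV_chain2[OF _ cayley_derivative[OF z]])
  show "(cayley_cubic \<alpha> \<beta> \<gamma> has_field_derivative \<alpha> / 2 + \<beta> * p / 2 + \<gamma> * (3 * p\<^sup>2 - 1) / 4) (at p)" for p
    unfolding cayley_cubic_def [abs_def]
    by (auto intro!: derivative_eq_intros simp: field_simps power2_eq_square)
qed

text \<open>
  The real part of the convolution at \<open>p = u + i v\<close>, with \<open>v\<close> eliminated in favour of \<open>t = u v\<close>.
\<close>

definition shear_re :: "real \<Rightarrow> real \<Rightarrow> real \<Rightarrow> real" where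
  "shear_re k t u = (u - 1) / 4 + k / 8 * (u ^ 3 - 3 * t\<^sup>2 / u - u)"

text \<open>Up to a factor 8 and a constant, the function is (2 - k) u + k u^3 - 3 k t^2 / u. Every
  summand is nondecreasing, the linear one because k \<le> 2, and the cubic one is strictly
  increasing.\<close>

lemma shear_re_strict_mono:
  assumes "0 < k" "k \<le> 2" "0 < u" "u < u'"
  shows "shear_re k t u < shear_re k t u'"
proof -
  have "k * u ^ 3 < k * u' ^ 3" using assms by (simp add: power_strict_mono)
  moreover have "(2 - k) * u \<le> (2 - k) * u'" using assms by (simp add: mult_left_mono)
  moreover have "k * (3 * t\<^sup>2 / u') \<le> k * (3 * t\<^sup>2 / u)"
    using assms by (intro mult_left_mono divide_left_mono) auto
  moreover have "8 * shear_re k t u = (2 - k) * u + k * u ^ 3 - k * (3 * t\<^sup>2 / u) - 2" for u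
    by (simp add: shear_re_def algebra_simps diff_divide_distrib)
  ultimately have "8 * shear_re k t u < 8 * shear_re k t u'" by simp
  then show ?thesis by simp
qed

text \<open>The two parts differ only in the sign of the p^2 - 1 term. In h + cnj g that term
  therefore contributes only to the imaginary part, and the other two only to the real part. The
  convolution is the case s = c + d, k = c d.\<close>

locale cubic_shear =
  fixes F :: harmonic and s k :: real
  assumes s: "s > 0" and k: "0 < k" "k \<le> 2"
    and fst_F: "\<And>z. z \<in> unit_disk \<Longrightarrow>
      fst F z = cayley_cubic (1 / 4) (of_real s / 4) (of_real k / 4) (cayley z)"
    and snd_F: "\<And>z. z \<in> unit_disk \<Longrightarrow>
      snd F z = cayley_cubic (1 / 4) (- of_real s / 4) (of_real k / 4) (cayley z)"
begin

lemma derivatives: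
  assumes z: "z \<in> unit_disk"
  defines "A \<equiv> 1 / 8 + of_real k * (3 * (cayley z)\<^sup>2 - 1) / 16" and "B \<equiv> of_real s * cayley z / 8"
  shows "(fst F has_field_derivative (A + B) * (2 / (1 - z)\<^sup>2)) (at z)"
    and "(snd F has_field_derivative (A - B) * (2 / (1 - z)\<^sup>2)) (at z)"
proof -
  have z1: "z \<noteq> 1" using z by auto
  note D = has_field_derivative_transform_within_open[OF
      has_field_derivative_cayley_cubic[OF z1] open_ball z]
  show "(fst F has_field_derivative (A + B) * (2 / (1 - z)\<^sup>2)) (at z)"
    using D[OF fst_F[symmetric]] by (simp add: A_def B_def add_ac)
  show "(snd F has_field_derivative (A - B) * (2 / (1 - z)\<^sup>2)) (at z)"
    using D[OF snd_F[symmetric]] by (simp add: A_def B_def add_diff_eq[symmetric] diff_add_eq)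
qed

lemma holomorphic: "fst F holomorphic_on unit_disk" "snd F holomorphic_on unit_disk"
  unfolding holomorphic_on_open[OF open_ball] using derivatives by blast+

lemma at_0: "fst F 0 = 0" "snd F 0 = 0" "deriv (fst F) 0 = of_real ((1 + s + k) / 4)"
  using fst_F[of 0] snd_F[of 0] derivatives(1)[of 0, THEN DERIV_imp_deriv]
  by (simp_all add: cayley_0 cayley_cubic_def add_divide_distrib distrib_right)

lemma sense_preserving: "sense_preserving F"
  unfolding sense_preserving_def
proof
  fix z assume z: "z \<in> unit_disk"
  define p where "p = cayley z"
  define A B where "A = 1 / 8 + of_real k * (3 * p\<^sup>2 - 1) / 16" and "B = of_real s * p / 8"
  have z1: "1 - z \<noteq> 0" using z by auto
  have p: "Re p > 0" unfolding p_def by (rule Re_cayley[OF z])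
  have "hjacobian F z = ((cmod (A + B))\<^sup>2 - (cmod (A - B))\<^sup>2) * (cmod (2 / (1 - z)\<^sup>2))\<^sup>2"
    unfolding hjacobian_def derivatives[OF z, THEN DERIV_imp_deriv] p_def[symmetric]
      A_def[symmetric] B_def[symmetric] norm_mult power_mult_distrib
    by (simp add: left_diff_distrib)
  moreover have "(cmod (A + B))\<^sup>2 - (cmod (A - B))\<^sup>2 = 4 * Re (A * cnj B)"
    unfolding cmod_power2 by (simp add: power2_eq_square algebra_simps)
  \<comment> \<open>Here \<open>cnj B\<close> is s/8 times the conjugate of p, and Re (p^2 * cnj p)
    = |p|^2 Re p. Positivity again rests on 2 - k \<ge> 0.\<close>
  moreover have "Re (A * cnj B) = s / 128 * Re p * ((2 - k) + 3 * k * ((Re p)\<^sup>2 + (Im p)\<^sup>2))"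
    unfolding A_def B_def by (simp add: power2_eq_square field_simps)
  moreover have "\<dots> > 0"
    using s k p by (intro mult_pos_pos add_nonneg_pos add_pos_nonneg) auto
  moreover have "(cmod (2 / (1 - z)\<^sup>2))\<^sup>2 > 0" using z1 by simp
  ultimately show "hjacobian F z > 0" by simp
qed

lemma hmap_shear:
  assumes z: "z \<in> unit_disk" and p: "p = cayley z"
  shows "hmap F z = Complex (shear_re k (Re p * Im p) (Re p)) (s / 4 * (Re p * Im p))"
proof -
  have "Re p > 0" unfolding p by (rule Re_cayley[OF z])
  then have "(Re p * Im p)\<^sup>2 / Re p = Re p * (Im p)\<^sup>2" by (simp add: power2_eq_square)
  then have t: "3 * (Re p * Im p)\<^sup>2 / Re p = 3 * (Re p * (Im p)\<^sup>2)" by simp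
  show ?thesis
    unfolding hmap_def fst_F[OF z] snd_F[OF z] p[symmetric] cayley_cubic_def shear_re_def t
    by (simp add: complex_eq_iff power2_eq_square power3_eq_cube field_simps)
qed

lemma univalent: "univalent F"
  unfolding univalent_def
proof (rule inj_onI)
  fix z z' assume z: "z \<in> unit_disk" "z' \<in> unit_disk" and eq: "hmap F z = hmap F z'"
  define p p' where "p = cayley z" and "p' = cayley z'"
  have pos: "Re p > 0" "Re p' > 0" using z by (auto simp: p_def p'_def intro!: Re_cayley)
  from eq have t: "Re p * Im p = Re p' * Im p'"
    and e: "shear_re k (Re p * Im p) (Re p) = shear_re k (Re p' * Im p') (Re p')"
    unfolding hmap_shear[OF z(1) p_def] hmap_shear[OF z(2) p'_def] using s by auto
  \<comment> \<open>Equal imaginary parts put both points on the same hyperbola u v = t, along which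
    the real part is strictly increasing in u. Equal u then forces equal v.\<close>
  have "Re p = Re p'"
    using shear_re_strict_mono[OF k pos(1), of "Re p'" "Re p * Im p"]
      shear_re_strict_mono[OF k pos(2), of "Re p" "Re p * Im p"] e
    unfolding t by (cases "Re p" "Re p'" rule: linorder_cases) auto
  with t pos have "p = p'" by (simp add: complex_eq_iff)
  then show "z = z'" using inj_on_cayley z by (auto simp: p_def p'_def dest: inj_onD)
qed

text \<open>The preimage of a horizontal line is the branch u v = 4 y / s in the right half-plane, a
  graph over u > 0. The slice is thus a continuous image of a ray, hence connected.\<close>

lemma horizontal_slice:
  "hmap F ` unit_disk \<inter> {w. Im w = y} = (\<lambda>u. Complex (shear_re k (4 * y / s) u) y) ` {0<..}"
proof (intro equalityI subsetI)
  fix w assume "w \<in> hmap F ` unit_disk \<inter> {w. Im w = y}"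
  then obtain z where z: "z \<in> unit_disk" and w: "w = hmap F z" "Im w = y" by auto
  define p where "p = cayley z"
  have pos: "Re p > 0" unfolding p_def by (rule Re_cayley[OF z])
  have "s / 4 * (Re p * Im p) = y" using w unfolding hmap_shear[OF z p_def] by simp
  then have "Re p * Im p = 4 * y / s" using s by (simp add: field_simps)
  with w pos show "w \<in> (\<lambda>u. Complex (shear_re k (4 * y / s) u) y) ` {0<..}"
    unfolding hmap_shear[OF z p_def] by auto
next
  fix w assume "w \<in> (\<lambda>u. Complex (shear_re k (4 * y / s) u) y) ` {0<..}"
  then obtain u where u: "u > 0" and w: "w = Complex (shear_re k (4 * y / s) u) y" by auto
  have "Complex u (4 * y / s / u) \<in> cayley ` unit_disk" unfolding cayley_image using u by simp
  then obtain z where z: "z \<in> unit_disk" and p: "Complex u (4 * y / s / u) = cayley z" by auto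
  have "hmap F z = w" unfolding hmap_shear[OF z p] w using u s by simp
  moreover have "Im w = y" by (simp add: w)
  ultimately show "w \<in> hmap F ` unit_disk \<inter> {w. Im w = y}" using z by blast
qed

lemma CHD: "CHD F"
  unfolding CHD_def CHD_domain_def complex_domain_def
proof (intro conjI allI)
  have cont: "continuous_on unit_disk (hmap F)"
    unfolding hmap_def [abs_def]
    by (intro continuous_intros holomorphic_on_imp_continuous_on holomorphic)
  show "hmap F ` unit_disk \<noteq> {}" by simp
  \<comment> \<open>A harmonic map need not be holomorphic, so openness comes from injectivity and
    continuity through invariance of domain.\<close>
  show "open (hmap F ` unit_disk)"
    using univalent by (intro invariance_of_domain cont) (auto simp: univalent_def)
  show "connected (hmap F ` unit_disk)"
    by (intro connected_continuous_image cont) simp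
  show "connected (hmap F ` unit_disk \<inter> {w. Im w = y})" for y
    unfolding horizontal_slice Complex_eq shear_re_def
    by (intro connected_continuous_image continuous_intros) auto
qed

end

section \<open>Passing between normalized and unnormalized pairs\<close>

lemma hscale_in_S_H:
  assumes "fst F holomorphic_on unit_disk" "snd F holomorphic_on unit_disk"
    and "sense_preserving F" "univalent F"
    and "fst F 0 = 0" "snd F 0 = 0" "deriv (fst F) 0 = of_real (1 / r)" "r \<noteq> 0"
  shows "hscale r F \<in> S_H"
proof -
  have D: "deriv (fst (hscale r F)) z = of_real r * deriv (fst F) z"
    "deriv (snd (hscale r F)) z = of_real r * deriv (snd F) z" if "z \<in> unit_disk" for z
    unfolding hscale_def fst_conv snd_conv
    using assms(1,2) that
    by (auto intro!: deriv_cmult simp: holomorphic_on_open field_differentiable_def)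
  \<comment> \<open>Both derivatives are multiplied by r, so the sign of the Jacobian is
    kept.\<close>
  have "hjacobian (hscale r F) z = r\<^sup>2 * hjacobian F z" if "z \<in> unit_disk" for z
    unfolding hjacobian_def D[OF that]
    by (simp add: norm_mult power_mult_distrib right_diff_distrib)
  with assms(3,8) have "sense_preserving (hscale r F)" by (simp add: sense_preserving_def)
  moreover have "univalent (hscale r F)"
    using assms(4,8) by (auto simp: univalent_def inj_on_def hmap_hscale)
  moreover have "fst (hscale r F) holomorphic_on unit_disk" "snd (hscale r F) holomorphic_on unit_disk"
    unfolding hscale_def fst_conv snd_conv using assms(1,2) by (intro holomorphic_intros; simp)+
  moreover have "deriv (fst (hscale r F)) 0 = 1" using D(1)[of 0] assms(7,8) by simp
  ultimately show ?thesis
    using assms(5,6) by (simp add: S_H_def) (simp add: hscale_def)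
qed

lemma hscale_in_S_H_D:
  assumes "hscale r (h, g) \<in> S_H" and r: "r \<noteq> 0"
  shows "h holomorphic_on unit_disk" "g holomorphic_on unit_disk" "h 0 = 0"
    and "\<And>z. z \<in> unit_disk \<Longrightarrow> deriv h z \<noteq> 0"
proof -
  have hol: "(\<lambda>z. of_real r * h z) holomorphic_on unit_disk"
    "(\<lambda>z. of_real r * g z) holomorphic_on unit_disk" and h0: "h 0 = 0"
    and sp: "sense_preserving (hscale r (h, g))"
    using assms by (auto simp: S_H_def hscale_def)
  have "(\<lambda>z. of_real (1 / r) * (of_real r * h z)) holomorphic_on unit_disk"
    "(\<lambda>z. of_real (1 / r) * (of_real r * g z)) holomorphic_on unit_disk"
    by (intro holomorphic_intros hol)+
  then show h: "h holomorphic_on unit_disk" and "g holomorphic_on unit_disk"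
    using r by simp_all
  show "h 0 = 0" by (rule h0)
  fix z assume z: "z \<in> unit_disk"
  have "deriv (\<lambda>z. of_real r * h z) z = of_real r * deriv h z"
    using h z by (intro deriv_cmult) (auto simp: holomorphic_on_open field_differentiable_def)
  \<comment> \<open>A positive Jacobian means |h'|^2 > |g'|^2 \<ge> 0 for the scaled parts.\<close>
  moreover have "deriv (\<lambda>z. of_real r * h z) z \<noteq> 0"
    using sp z by (force simp: sense_preserving_def hjacobian_def hscale_def)
  ultimately show "deriv h z \<noteq> 0" by auto
qed

theorem theorem2p5:
  fixes a b :: real and h g :: "complex \<Rightarrow> complex"
  assumes "\<bar>a\<bar> < 1" and "\<bar>b\<bar> < 1"
    and "hscale (1 + a) (half_plane_map a) \<in> K_H"
    and "hscale (1 + b) (h, g) \<in> K_H"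
    and "\<forall>z\<in>unit_disk. h z + g z = z / (1 - z)"
    and "\<forall>z\<in>unit_disk. dilatation (h, g) z = (of_real b - z) / (1 - of_real b * z)"
    and "b \<ge> - ((1 + 3 * a) / (3 + a))"
  shows "hscale ((1 + a) * (1 + b)) (harmonic_conv (half_plane_map a) (h, g)) \<in> S_H \<and>
         CHD (harmonic_conv (half_plane_map a) (h, g))"
proof -
  define c d where "c = (1 - a) / (1 + a)" and "d = (1 - b) / (1 + b)"
  have a: "\<bar>a\<bar> < 1" and b: "\<bar>b\<bar> < 1" by fact+
  have a1: "1 + a > 0" "1 - a > 0" and b1: "1 + b > 0" "1 - b > 0" using a b by auto
  have pos: "c > 0" "d > 0" unfolding c_def d_def using a1 b1 by simp_all
  have "- (1 + 3 * a) \<le> b * (3 + a)"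
    using assms(7) a1 by (simp add: divide_le_eq minus_divide_left)
  \<comment> \<open>Both this inequality and the hypothesis on b, after multiplication by 3 + a > 0,
    amount to 1 + 3 a + 3 b + a b \<ge> 0.\<close>
  then have "(1 - a) * (1 - b) \<le> 2 * ((1 + a) * (1 + b))" by (simp add: algebra_simps)
  then have cd: "c * d \<le> 2" unfolding c_def d_def using a1 b1 by (simp add: divide_le_eq)
  have "hscale (1 + b) (h, g) \<in> S_H" using assms(4) by (simp add: K_H_def)
  note D = hscale_in_S_H_D[OF this]
  have hg: "h z = fst (half_plane_map b) z" "g z = snd (half_plane_map b) z"
    if "z \<in> unit_disk" for z
    using half_plane_map_unique[OF b D _ _ that] assms(5,6) b1 by auto
  let ?F = "harmonic_conv (half_plane_map a) (h, g)"
  interpret cubic_shear ?F "c + d" "c * d"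
  proof
    note A = half_plane_map_cayley[OF a, folded c_def]
    have B: "h z = cayley_cubic (1 / 2) (of_real d / 2) 0 (cayley z)"
      "g z = cayley_cubic (1 / 2) (- of_real d / 2) 0 (cayley z)" if "z \<in> unit_disk" for z
      using half_plane_map_cayley[OF b that, folded d_def] hg[OF that] by simp_all
    show "fst ?F z = cayley_cubic (1 / 4) (of_real (c + d) / 4) (of_real (c * d) / 4) (cayley z)"
      if "z \<in> unit_disk" for z
      using hadamard_cayley_linear[OF A(1) B(1) that] by (simp add: harmonic_conv_def)
    \<comment> \<open>The co-analytic parts have slopes -c and -d: their sum changes sign, their
      product does not, which is the sign pattern of \<open>cubic_shear\<close>.\<close>
    show "snd ?F z = cayley_cubic (1 / 4) (- of_real (c + d) / 4) (of_real (c * d) / 4) (cayley z)"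
      if "z \<in> unit_disk" for z
      using hadamard_cayley_linear[OF A(2) B(2) that] by (simp add: harmonic_conv_def)
  qed (use pos cd in auto)
  have "1 + c = 2 / (1 + a)" "1 + d = 2 / (1 + b)"
    unfolding c_def d_def using a1 b1 by (simp_all add: field_simps)
  then have cd': "(1 + c) * (1 + d) = 4 / ((1 + a) * (1 + b))" by simp
  \<comment> \<open>The left side is the derivative of the analytic part at 0; its factorization
    shows that (1 + a)(1 + b) is the normalizing factor.\<close>
  have "(1 + (c + d) + c * d) / 4 = (1 + c) * (1 + d) / 4" by (simp add: algebra_simps)
  also have "\<dots> = 1 / ((1 + a) * (1 + b))" unfolding cd' by simp
  finally have "hscale ((1 + a) * (1 + b)) ?F \<in> S_H"
    using a1 b1 at_0 by (intro hscale_in_S_H holomorphic sense_preserving univalent) (simp_all only:, auto)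
  with CHD show ?thesis by blast
qed

end
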